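(* Let $X$ be a finite ground set, let $d\ge 0$ be an integer, and let $f:2^X\to\mathbb{R}$ be a normalized monotone set function. Then $f$ is $d$-scopic submodular if and only if $\mathrm{SMW}(f)\le d$.
   Context: A set function $f:2^X\to\mathbb{R}$ is normalized if $f(\emptyset)=0$ and monotone if $f(S)\le f(T)$ whenever $S\subseteq T\subseteq X$. For $S,T\subseteq X$ write $f(S\mid T)=f(S\cup T)-f(T)$, and $f(v\mid T)=f(\{v\}\mid T)$ for $v\in X$. A set $T\subseteq X$ is supermodular w.r.t. $f$ if there exist $S\subseteq X$ and $v\in X\setminus T$ such that $f(v\mid S\cup T)>\max_{T'\subsetneq T} f(v\mid S\cup T')$. The supermodular width $\mathrm{SMW}(f)$ is the maximum cardinality of a nonempty supermodular set w.r.t. $f$ (and $0$ if there is none). For an integer $d\ge 0$, $f$ is $d$-scopic submodular if for all $S,T\subseteq X$ and $v\in X$ with $S\subseteq T$ and $v\notin T$: $f(v\mid T)\le \max_{T'\subseteq T,\ |T'|\le d} f(v\mid S\cup T')$. *)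

theory Defs
  imports Complex_Main
begin

definition normalized :: "('a set \<Rightarrow> real) \<Rightarrow> bool" where
  "normalized f \<longleftrightarrow> f {} = 0"

definition monotone_set_fun :: "'a set \<Rightarrow> ('a set \<Rightarrow> real) \<Rightarrow> bool" where
  "monotone_set_fun X f \<longleftrightarrow> (\<forall>S T. S \<subseteq> T \<and> T \<subseteq> X \<longrightarrow> f S \<le> f T)"

definition marginal :: "('a set \<Rightarrow> real) \<Rightarrow> 'a set \<Rightarrow> 'a set \<Rightarrow> real" where
  "marginal f S T = f (S \<union> T) - f T"

(* For T = {} the maximum ranges over the empty set and is unspecified; only nonempty T
   are ever considered, in the definition of SMW below. *)
definition supermodular_set :: "'a set \<Rightarrow> ('a set \<Rightarrow> real) \<Rightarrow> 'a set \<Rightarrow> bool" where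
  "supermodular_set X f T \<longleftrightarrow> T \<subseteq> X \<and>
     (\<exists>S v. S \<subseteq> X \<and> v \<in> X - T \<and>
        marginal f {v} (S \<union> T) > (MAX T'\<in>{T'. T' \<subset> T}. marginal f {v} (S \<union> T')))"

definition SMW :: "'a set \<Rightarrow> ('a set \<Rightarrow> real) \<Rightarrow> nat" where
  "SMW X f = (if \<exists>T. T \<noteq> {} \<and> supermodular_set X f T
              then Max {card T | T. T \<noteq> {} \<and> supermodular_set X f T}
              else 0)"

definition scopic_submodular :: "nat \<Rightarrow> 'a set \<Rightarrow> ('a set \<Rightarrow> real) \<Rightarrow> bool" where
  "scopic_submodular d X f \<longleftrightarrow>
     (\<forall>S T v. T \<subseteq> X \<and> S \<subseteq> T \<and> v \<in> X \<and> v \<notin> T \<longrightarrow>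
        marginal f {v} T \<le> (MAX T'\<in>{T'. T' \<subseteq> T \<and> card T' \<le> d}. marginal f {v} (S \<union> T')))"

end

theory Submission imports Defs begin

text \<open>
  A nonempty \<open>T\<close> is supermodular iff it is a strict peak of some \<open>g = (\<lambda>T'. f(v | S \<union> T'))\<close> with
  \<open>v \<notin> T\<close>. Since \<open>g\<close> only sees \<open>T'\<close> modulo \<open>S\<close>, a set \<open>T' \<subseteq> S \<union> T\<close> with \<open>g T' \<ge> g T\<close> must contain the
  whole strict peak \<open>T\<close>, so the small sets provided by scopic submodularity bound \<open>card T\<close>.
  Conversely, every finite \<open>T\<close> contains a strict peak \<open>M\<close> with \<open>g M \<ge> g T\<close>, namely an inclusion-minimal
  \<open>M\<close> with this property, and \<open>M\<close> serves as the set required by scopic submodularity.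
\<close>

definition strict_peak :: "('a set \<Rightarrow> 'b::order) \<Rightarrow> 'a set \<Rightarrow> bool" where
  "strict_peak g T \<longleftrightarrow> (\<forall>T'. T' \<subset> T \<longrightarrow> g T' < g T)"

lemma strict_peak_subset_if_le:
  assumes peak: "strict_peak (\<lambda>T'. g (S \<union> T')) T"
    and "T' \<subseteq> S \<union> T" and "g (S \<union> T) \<le> g (S \<union> T')"
  shows "T \<subseteq> T'"
proof -
  have "S \<union> (T' \<inter> T) = S \<union> T'"
    using \<open>T' \<subseteq> S \<union> T\<close> by blast
  then have "g (S \<union> T) \<le> g (S \<union> (T' \<inter> T))"
    using \<open>g (S \<union> T) \<le> g (S \<union> T')\<close> by simp
  then have "\<not> T' \<inter> T \<subset> T"
    using peak by (auto simp: strict_peak_def dest: leD)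
  then show ?thesis
    by blast
qed

lemma obtain_strict_peak_subset:
  fixes g :: "'a set \<Rightarrow> 'b::linorder"
  assumes "finite T"
  obtains M where "M \<subseteq> T" "g T \<le> g M" "strict_peak g M"
proof -
  define A where "A = {T'. T' \<subseteq> T \<and> g T \<le> g T'}"
  have "finite A" "T \<in> A"
    using assms by (auto simp: A_def)
  then obtain M where "M \<in> A" and minimal: "\<And>T'. T' \<in> A \<Longrightarrow> T' \<subseteq> M \<Longrightarrow> M = T'"
    using finite_has_minimal[of A] by blast
  have "g T' < g M" if "T' \<subset> M" for T'
  proof -
    have "T' \<notin> A"
      using minimal that by blast
    then have "g T' < g T"
      using that \<open>M \<in> A\<close> by (auto simp: A_def)
    also have "g T \<le> g M"
      using \<open>M \<in> A\<close> by (simp add: A_def)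
    finally show ?thesis .
  qed
  then have "strict_peak g M"
    by (simp add: strict_peak_def)
  then show thesis
    using that \<open>M \<in> A\<close> unfolding A_def by blast
qed

lemma Max_psubsets_less_iff:
  fixes g :: "'a set \<Rightarrow> 'b::linorder"
  assumes "finite T" and "T \<noteq> {}"
  shows "(MAX T'\<in>{T'. T' \<subset> T}. g T') < g T \<longleftrightarrow> strict_peak g T"
proof -
  have "finite {T'. T' \<subset> T}"
    using assms(1) by (simp add: psubset_eq)
  moreover have "{T'. T' \<subset> T} \<noteq> {}"
    using assms(2) by blast
  ultimately show ?thesis
    by (simp add: strict_peak_def)
qed

lemma le_Max_subsets_card_le_iff:
  fixes g :: "'a set \<Rightarrow> 'b::linorder"
  assumes "finite T"
  shows "m \<le> (MAX T'\<in>{T'. T' \<subseteq> T \<and> card T' \<le> d}. g T') \<longleftrightarrow>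
    (\<exists>T'\<subseteq>T. card T' \<le> d \<and> m \<le> g T')"
proof -
  have "finite {T'. T' \<subseteq> T \<and> card T' \<le> d}"
    using assms by simp
  moreover have "{} \<in> {T'. T' \<subseteq> T \<and> card T' \<le> d}"
    by simp
  ultimately show ?thesis
    by (subst Max_ge_iff) (blast, blast, blast)
qed

lemma marginal_eq_0_if_subset: "S \<subseteq> T \<Longrightarrow> marginal f S T = 0"
  by (simp add: marginal_def Un_absorb1)

lemma supermodular_set_iff_strict_peak:
  assumes "finite T" and "T \<noteq> {}"
  shows "supermodular_set X f T \<longleftrightarrow> T \<subseteq> X \<and>
    (\<exists>S v. S \<subseteq> X \<and> v \<in> X - T \<and> strict_peak (\<lambda>T'. marginal f {v} (S \<union> T')) T)"
proof -
  have "(MAX T'\<in>{T'. T' \<subset> T}. marginal f {v} (S \<union> T')) < marginal f {v} (S \<union> T) \<longleftrightarrow>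
      strict_peak (\<lambda>T'. marginal f {v} (S \<union> T')) T" for S v
    using assms by (rule Max_psubsets_less_iff)
  then show ?thesis
    by (simp add: supermodular_set_def)
qed

lemma supermodular_setE:
  assumes "supermodular_set X f T" and "finite T" and "T \<noteq> {}"
  obtains S v where "S \<union> T \<subseteq> X" "v \<in> X" "v \<notin> S \<union> T"
    "strict_peak (\<lambda>T'. marginal f {v} (S \<union> T')) T"
proof -
  obtain S v where "T \<subseteq> X" "S \<subseteq> X" "v \<in> X" "v \<notin> T"
    and peak: "strict_peak (\<lambda>T'. marginal f {v} (S \<union> T')) T"
    using assms(1) unfolding supermodular_set_iff_strict_peak[OF assms(2,3)] by blast
  have "marginal f {v} (S \<union> {}) < marginal f {v} (S \<union> T)"
    using peak \<open>T \<noteq> {}\<close> by (auto simp: strict_peak_def)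
  moreover have "marginal f {v} (S \<union> T') = 0" if "v \<in> S" for T'
    using that by (simp add: marginal_eq_0_if_subset)
  ultimately have "v \<notin> S"
    by (metis less_irrefl)
  then show thesis
    using that peak \<open>T \<subseteq> X\<close> \<open>S \<subseteq> X\<close> \<open>v \<in> X\<close> \<open>v \<notin> T\<close> by blast
qed

lemma SMW_le_iff:
  assumes "finite X"
  shows "SMW X f \<le> d \<longleftrightarrow> (\<forall>T. T \<noteq> {} \<and> supermodular_set X f T \<longrightarrow> card T \<le> d)"
proof -
  have "{card T | T. T \<noteq> {} \<and> supermodular_set X f T} \<subseteq> card ` Pow X"
    by (auto simp: supermodular_set_def)
  then have "finite {card T | T. T \<noteq> {} \<and> supermodular_set X f T}"
    using assms by (simp add: finite_subset)
  then show ?thesis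
    unfolding SMW_def by auto
qed

lemma scopic_submodular_iff:
  assumes "finite X"
  shows "scopic_submodular d X f \<longleftrightarrow>
    (\<forall>S T v. T \<subseteq> X \<and> S \<subseteq> T \<and> v \<in> X \<and> v \<notin> T \<longrightarrow>
      (\<exists>T'\<subseteq>T. card T' \<le> d \<and> marginal f {v} T \<le> marginal f {v} (S \<union> T')))"
  unfolding scopic_submodular_def
  by (intro iff_allI imp_cong refl le_Max_subsets_card_le_iff)
    (use assms finite_subset in blast)

lemma card_supermodular_set_le:
  assumes "finite X" and scopic: "scopic_submodular d X f"
    and "supermodular_set X f T" and "T \<noteq> {}"
  shows "card T \<le> d"
proof -
  have "finite T"
    using assms(1,3) by (auto simp: supermodular_set_def intro: finite_subset)
  then obtain S v where "S \<union> T \<subseteq> X" "v \<in> X" "v \<notin> S \<union> T"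
    and peak: "strict_peak (\<lambda>T'. marginal f {v} (S \<union> T')) T"
    using assms(3,4) by (elim supermodular_setE)
  then obtain T' where "T' \<subseteq> S \<union> T" "card T' \<le> d"
    and "marginal f {v} (S \<union> T) \<le> marginal f {v} (S \<union> T')"
    using scopic unfolding scopic_submodular_iff[OF assms(1)] by (meson Un_upper1)
  then have "T \<subseteq> T'"
    using strict_peak_subset_if_le[OF peak] by blast
  moreover have "finite T'"
    using \<open>T' \<subseteq> S \<union> T\<close> \<open>S \<union> T \<subseteq> X\<close> assms(1) by (meson finite_subset)
  ultimately have "card T \<le> card T'"
    by (intro card_mono)
  also note \<open>card T' \<le> d\<close>
  finally show ?thesis .
qed

lemma scopic_submodular_if_card_supermodular_set_le:
  assumes "finite X"
    and card_le: "\<And>T. supermodular_set X f T \<Longrightarrow> T \<noteq> {} \<Longrightarrow> card T \<le> d"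
  shows "scopic_submodular d X f"
  unfolding scopic_submodular_iff[OF assms(1)]
proof (intro allI impI, elim conjE)
  fix S T v
  assume "T \<subseteq> X" "S \<subseteq> T" "v \<in> X" "v \<notin> T"
  have "finite T"
    using \<open>T \<subseteq> X\<close> assms(1) by (rule finite_subset)
  then obtain M where "M \<subseteq> T" and le: "marginal f {v} (S \<union> T) \<le> marginal f {v} (S \<union> M)"
    and peak: "strict_peak (\<lambda>T'. marginal f {v} (S \<union> T')) M"
    by (rule obtain_strict_peak_subset)
  have "card M \<le> d"
  proof (cases "M = {}")
    case False
    have "finite M"
      using \<open>M \<subseteq> T\<close> \<open>finite T\<close> by (rule finite_subset)
    have "supermodular_set X f M"
      unfolding supermodular_set_iff_strict_peak[OF \<open>finite M\<close> False]
      using peak \<open>M \<subseteq> T\<close> \<open>T \<subseteq> X\<close> \<open>S \<subseteq> T\<close> \<open>v \<in> X\<close> \<open>v \<notin> T\<close> by blast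
    then show ?thesis
      using False by (rule card_le)
  qed simp
  moreover have "marginal f {v} T \<le> marginal f {v} (S \<union> M)"
    using le \<open>S \<subseteq> T\<close> by (simp add: Un_absorb1)
  ultimately show "\<exists>T'\<subseteq>T. card T' \<le> d \<and> marginal f {v} T \<le> marginal f {v} (S \<union> T')"
    using \<open>M \<subseteq> T\<close> by blast
qed

theorem theorem1:
  fixes X :: "'a set" and d :: nat and f :: "'a set \<Rightarrow> real"
  assumes "finite X"
    and "normalized f"
    and "monotone_set_fun X f"
  shows "scopic_submodular d X f \<longleftrightarrow> SMW X f \<le> d"
proof
  assume "scopic_submodular d X f"
  then show "SMW X f \<le> d"
    unfolding SMW_le_iff[OF \<open>finite X\<close>] using card_supermodular_set_le[OF \<open>finite X\<close>] by blast
next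
  assume "SMW X f \<le> d"
  then show "scopic_submodular d X f"
    unfolding SMW_le_iff[OF \<open>finite X\<close>]
    by (intro scopic_submodular_if_card_supermodular_set_le[OF \<open>finite X\<close>]) blast
qed

end
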